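(* Let $p$ be a prime that is not a Wieferich prime. Then $M(p) = M(p^k)$ for every positive integer $k$.
   Context: For a positive integer $m$, $s_2(m)$ denotes the number of $1$'s in the binary expansion of $m$ (the Hamming weight of $m$). For a positive integer $n$, $M(n) := \min_{k\ge 1} s_2(kn)$, the minimum being over all positive integers $k$. A prime $p$ is a Wieferich prime if $p^2 \mid 2^{p-1}-1$. *)

theory Defs
  imports Complex_Main "HOL-Computational_Algebra.Primes"
begin

definition s2 :: "nat \<Rightarrow> nat" where
  "s2 m = card {i. bit m i}"

text \<open>\<open>bit m i\<close> holds for only finitely many \<open>i\<close>, so the cardinality is never the default
  value of an infinite set. The lemmas \<open>s2_0\<close> and \<open>s2_rec\<close> characterise
  \<open>s2\<close> as the binary digit sum.\<close>

lemma finite_bits_nat: "finite {i. bit (m::nat) i}"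
proof (rule finite_subset)
  show "{i. bit m i} \<subseteq> {..<m}"
  proof
    fix i assume "i \<in> {i. bit m i}"
    then have "m div 2 ^ i \<noteq> 0" by (auto simp: bit_iff_odd intro: odd_pos)
    then have "2 ^ i \<le> m" by (simp add: div_eq_0_iff)
    then show "i \<in> {..<m}" using less_le_trans[OF less_exp] by simp
  qed
qed simp

lemma s2_0: "s2 0 = 0"
  by (simp add: s2_def)

lemma s2_rec: "s2 m = m mod 2 + s2 (m div 2)"
proof -
  have split: "{i. bit m i} = {i. i = 0 \<and> odd m} \<union> Suc ` {i. bit (m div 2) i}"
  proof (intro set_eqI iffI)
    fix i assume "i \<in> {i. bit m i}"
    then show "i \<in> {i. i = 0 \<and> odd m} \<union> Suc ` {i. bit (m div 2) i}"
      by (cases i) (auto simp: bit_0 bit_Suc)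
  next
    fix i assume "i \<in> {i. i = 0 \<and> odd m} \<union> Suc ` {i. bit (m div 2) i}"
    then show "i \<in> {i. bit m i}"
      by (auto simp: bit_0 bit_Suc)
  qed
  have "card {i. bit m i} = card {i. i = (0::nat) \<and> odd m} + card (Suc ` {i. bit (m div 2) i})"
    unfolding split by (rule card_Un_disjoint) (auto simp: finite_bits_nat)
  also have "card {i. i = (0::nat) \<and> odd m} = m mod 2"
    by (cases "odd m") (auto simp: odd_iff_mod_2_eq_one)
  also have "card (Suc ` {i. bit (m div 2) i}) = card {i. bit (m div 2) i}"
    by (rule card_image) simp
  finally show ?thesis
    by (simp add: s2_def)
qed

text \<open>The infimum of a nonempty set of natural numbers is its minimum.\<close>

definition M :: "nat \<Rightarrow> nat" where
  "M n = (INF k\<in>{1..}. s2 (k * n))"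

lemma M_attained: "\<exists>k\<ge>1. M n = s2 (k * n)"
proof -
  have "(INF k\<in>{1..}. s2 (k * n)) \<in> (\<lambda>k. s2 (k * n)) ` {1..}"
    by (rule Inf_nat_def1) simp
  then show ?thesis
    by (auto simp: M_def)
qed

lemma M_le: "k \<ge> 1 \<Longrightarrow> M n \<le> s2 (k * n)"
  unfolding M_def by (rule cINF_lower) auto

text \<open>The subtraction on \<open>nat\<close> does not truncate, since \<open>2 ^ (p - 1) \<ge> 1\<close>.\<close>

definition wieferich_prime :: "nat \<Rightarrow> bool" where
  "wieferich_prime p \<longleftrightarrow> prime p \<and> p\<^sup>2 dvd 2 ^ (p - 1) - 1"

end

theory Submission
  imports Defs "HOL-Number_Theory.Number_Theory"
begin

text \<open>
  Since \<open>M p \<le> M (p ^ k)\<close> is clear, take a multiple \<open>r + 2 ^ a\<close> of an odd \<open>p\<close> of minimal weight,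
  split off one binary digit, and move only that digit. As \<open>p\<close> is not a Wieferich prime,
  \<open>2 ^ ((p - 1) * p ^ (k - 1)) - 1\<close> is divisible by \<open>p ^ k\<close> exactly, so the exponent \<open>a\<close> can be
  corrected as in Hensel lifting until \<open>r + 2 ^ b\<close> is divisible by \<open>p ^ k\<close>. A collision of digits
  can only lower the weight.
\<close>

section \<open>Adding and removing one binary digit\<close>

lemma s2_even: "even m \<Longrightarrow> s2 m = s2 (m div 2)"
  by (subst s2_rec) simp

lemma s2_odd: "odd m \<Longrightarrow> s2 m = Suc (s2 (m div 2))"
  by (subst s2_rec) (simp add: odd_iff_mod_2_eq_one)

text \<open>A carry clears the trailing ones of \<open>m\<close> and then sets a single
  digit.\<close>

lemma s2_Suc_le: "s2 (Suc m) \<le> Suc (s2 m)"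
proof (induction m rule: less_induct)
  case (less m)
  show ?case
  proof (cases "even m")
    case True
    then show ?thesis by (simp add: s2_even[of m] s2_odd[of "Suc m"])
  next
    case False
    then have "m div 2 < m" by (auto elim: oddE)
    then have "s2 (Suc (m div 2)) \<le> Suc (s2 (m div 2))" by (rule less)
    moreover have "Suc m div 2 = Suc (m div 2)" using False by (auto elim: oddE)
    ultimately show ?thesis using False by (simp add: s2_odd[of m] s2_even[of "Suc m"])
  qed
qed

text \<open>The \<open>a\<close> lowest digits are unaffected, so stripping them one at a time
  reduces the claim to adding 1.\<close>

lemma s2_add_power_le: "s2 (m + 2 ^ a) \<le> Suc (s2 m)"
proof (induction a arbitrary: m)
  case 0
  then show ?case using s2_Suc_le[of m] by simp
next
  case (Suc a)
  have "s2 (m + 2 ^ Suc a) = m mod 2 + s2 (m div 2 + 2 ^ a)"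
    by (subst s2_rec) (simp add: add.commute)
  also have "\<dots> \<le> m mod 2 + Suc (s2 (m div 2))"
    using Suc by simp
  also have "\<dots> = Suc (s2 m)"
    by (subst (2) s2_rec) simp
  finally show ?case .
qed

text \<open>The power removed is the lowest digit 1 of \<open>m\<close>: halve until the number is
  odd, then clear its last digit.\<close>

lemma s2_split_power:
  assumes "m > 0"
  obtains r a where "m = r + 2 ^ a" "s2 m = Suc (s2 r)"
proof -
  have "\<exists>r a. m = r + 2 ^ a \<and> s2 m = Suc (s2 r)"
    using assms
  proof (induction m rule: less_induct)
    case (less m)
    show ?case
    proof (cases "even m")
      case True
      then have "m div 2 < m" "m div 2 > 0" using less.prems by auto
      from less.IH[OF this] obtain r a
        where ra: "m div 2 = r + 2 ^ a" "s2 (m div 2) = Suc (s2 r)" by blast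
      have "m = 2 * r + 2 ^ Suc a" using ra(1) True by auto
      moreover have "s2 m = Suc (s2 (2 * r))" using ra(2) True by (simp add: s2_even)
      ultimately show ?thesis by blast
    next
      case False
      then have "m = 2 * (m div 2) + 2 ^ 0" by simp
      moreover have "s2 m = Suc (s2 (2 * (m div 2)))"
        using False s2_even[of "2 * l" for l]
        by (metis dvd_triv_left nonzero_mult_div_cancel_left s2_odd zero_neq_numeral)
      ultimately show ?thesis by blast
    qed
  qed
  then show thesis using that by blast
qed

section \<open>Exact divisibility of \<open>2 ^ ((p - 1) * p ^ k) - 1\<close>\<close>

lemma power_one_plus_linear:
  fixes y :: "'a::comm_ring_1"
  shows "\<exists>z. (1 + y) ^ n = 1 + of_nat n * y + y\<^sup>2 * z"
proof (induction n)
  case (Suc n)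
  then obtain z where "(1 + y) ^ n = 1 + of_nat n * y + y\<^sup>2 * z" by blast
  then have "(1 + y) ^ Suc n = 1 + of_nat (Suc n) * y + y\<^sup>2 * (of_nat n + z + y * z)"
    by (simp add: algebra_simps power2_eq_square)
  then show ?case by blast
qed (auto intro: exI[of _ 0])

text \<open>Multiplied by 2 in order to avoid a division in the quadratic coefficient.\<close>

lemma power_one_plus_quadratic:
  fixes y :: "'a::comm_ring_1"
  shows "\<exists>z. 2 * (1 + y) ^ n = 2 + 2 * of_nat n * y + of_nat n * (of_nat n - 1) * y\<^sup>2 + y ^ 3 * z"
proof (induction n)
  case (Suc n)
  then obtain z
    where "2 * (1 + y) ^ n = 2 + 2 * of_nat n * y + of_nat n * (of_nat n - 1) * y\<^sup>2 + y ^ 3 * z"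
    by blast
  then have "2 * (1 + y) ^ Suc n =
      (1 + y) * (2 + 2 * of_nat n * y + of_nat n * (of_nat n - 1) * y\<^sup>2 + y ^ 3 * z)"
    by (metis mult.left_commute power_Suc)
  also have "\<dots> = 2 + 2 * of_nat (Suc n) * y + of_nat (Suc n) * (of_nat (Suc n) - 1) * y\<^sup>2
      + y ^ 3 * (of_nat n * (of_nat n - 1) + z + y * z)"
    by (simp add: algebra_simps power2_eq_square power3_eq_cube)
  finally show ?case by blast
qed (auto intro: exI[of _ 0])

text \<open>In the expansion of the \<open>p\<close>-th power the linear term is
  \<open>int p ^ Suc k * c\<close>, and everything beyond it is divisible by
  \<open>int p ^ (k + 2)\<close>. Hence \<open>d\<close> is congruent to \<open>c\<close> modulo
  \<open>p\<close>.\<close>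

lemma exact_power_lift:
  fixes p :: nat and c :: int
  assumes p: "prime p" "odd p" and k: "k \<ge> 1" and c: "\<not> int p dvd c"
  obtains d where "(1 + int p ^ k * c) ^ p = 1 + int p ^ Suc k * d" "\<not> int p dvd d"
proof -
  define y where "y = int p ^ k * c"
  obtain z where z: "2 * (1 + y) ^ p =
      2 + 2 * int p * y + int p * (int p - 1) * y\<^sup>2 + y ^ 3 * z"
    using power_one_plus_quadratic[of y p] by auto
  \<comment> \<open>For \<open>k = 1\<close> the square of \<open>y\<close> alone falls short; the
    factor \<open>int p\<close> of the coefficient makes up for it.\<close>
  have "int p ^ (k + 2) dvd int p * (int p - 1) * y\<^sup>2"
  proof -
    have "int p ^ (k + 2) dvd int p ^ (1 + k + k)" using k by (intro le_imp_power_dvd) auto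
    also have "\<dots> dvd int p ^ (1 + k + k) * ((int p - 1) * c\<^sup>2)" by simp
    also have "\<dots> = int p * (int p - 1) * y\<^sup>2"
      by (simp add: y_def power_add power2_eq_square ac_simps)
    finally show ?thesis .
  qed
  moreover have "int p ^ (k + 2) dvd y ^ 3 * z"
  proof -
    have "int p ^ (k + 2) dvd int p ^ (k + k + k)" using k by (intro le_imp_power_dvd) auto
    also have "\<dots> dvd int p ^ (k + k + k) * (c ^ 3 * z)" by simp
    also have "\<dots> = y ^ 3 * z"
      by (simp add: y_def power_add power3_eq_cube ac_simps)
    finally show ?thesis .
  qed
  ultimately have "int p ^ (k + 2) dvd int p * (int p - 1) * y\<^sup>2 + y ^ 3 * z"
    by (rule dvd_add)
  then obtain w where "int p * (int p - 1) * y\<^sup>2 + y ^ 3 * z = int p ^ (k + 2) * w" ..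
  then have eq: "2 * ((1 + y) ^ p - 1) = int p ^ Suc k * (2 * c + int p * w)"
    using z by (simp add: y_def algebra_simps)
  \<comment> \<open>Oddness of \<open>p\<close> allows the factor 2 of the doubled expansion to be
    cancelled.\<close>
  have "coprime (int p ^ Suc k) 2"
    using p(2) by simp
  then have "int p ^ Suc k dvd (1 + y) ^ p - 1"
    using eq by (metis coprime_dvd_mult_right_iff dvd_triv_left)
  then obtain d where d: "(1 + y) ^ p - 1 = int p ^ Suc k * d" ..
  have "int p ^ Suc k * (2 * d) = int p ^ Suc k * (2 * c + int p * w)"
    using eq unfolding d by (simp only: ac_simps)
  then have "2 * d = 2 * c + int p * w"
    using prime_gt_0_nat[OF p(1)] by simp
  then have "2 * c = 2 * d - int p * w" by simp
  have "\<not> int p dvd d"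
  proof
    assume "int p dvd d"
    then have "int p dvd 2 * c" unfolding \<open>2 * c = _\<close> by simp
    moreover have "coprime (int p) 2" using p(2) by simp
    ultimately show False using c by (simp add: coprime_dvd_mult_right_iff)
  qed
  moreover have "(1 + int p ^ k * c) ^ p = 1 + int p ^ Suc k * d"
    using d unfolding y_def by (simp add: algebra_simps)
  ultimately show thesis using that by blast
qed

text \<open>For \<open>k = 0\<close>, \<open>c\<close> is the Fermat quotient of 2, which
  \<open>p\<close> divides only if \<open>p\<close> is a Wieferich prime. Each further factor
  \<open>p\<close> in the exponent is handled by \<open>exact_power_lift\<close>.\<close>

lemma non_wieferich_power_exact:
  assumes p: "prime p" "odd p" and nw: "\<not> wieferich_prime p"
  obtains c where "(2::int) ^ ((p - 1) * p ^ k) = 1 + int p ^ Suc k * c" "\<not> int p dvd c"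
proof -
  have "\<exists>c. (2::int) ^ ((p - 1) * p ^ k) = 1 + int p ^ Suc k * c \<and> \<not> int p dvd c"
  proof (induction k)
    case 0
    have "[2 ^ (p - 1) = 1] (mod p)"
    proof (rule fermat_theorem[OF p(1)])
      show "\<not> p dvd 2"
        using p primes_dvd_imp_eq two_is_prime_nat by blast
    qed
    then have "int p dvd 2 ^ (p - 1) - 1"
      by (metis cong_iff_dvd_diff cong_int_iff of_nat_1 of_nat_numeral of_nat_power)
    then obtain c where c: "2 ^ (p - 1) - 1 = int p * c" ..
    have "\<not> int p dvd c"
    proof
      assume "int p dvd c"
      then have "int p * int p dvd 2 ^ (p - 1) - 1" unfolding c by simp
      moreover have "2 ^ (p - 1) - 1 = int (2 ^ (p - 1) - 1)"
        by (simp add: of_nat_diff)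
      ultimately have "int (p\<^sup>2) dvd int (2 ^ (p - 1) - 1)"
        by (simp add: power2_eq_square)
      then have "p\<^sup>2 dvd 2 ^ (p - 1) - 1" by (simp only: of_nat_dvd_iff)
      with nw p(1) show False by (simp add: wieferich_prime_def)
    qed
    moreover have "2 ^ ((p - 1) * p ^ 0) = 1 + int p ^ Suc 0 * c" using c by simp
    ultimately show ?case by blast
  next
    case (Suc k)
    then obtain c where c: "(2::int) ^ ((p - 1) * p ^ k) = 1 + int p ^ Suc k * c" "\<not> int p dvd c"
      by blast
    obtain d where d: "(1 + int p ^ Suc k * c) ^ p = 1 + int p ^ Suc (Suc k) * d" "\<not> int p dvd d"
      using exact_power_lift[OF p _ c(2), of "Suc k"] by auto
    have "(2::int) ^ ((p - 1) * p ^ Suc k) = (2 ^ ((p - 1) * p ^ k)) ^ p"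
      by (simp add: power_mult[symmetric] ac_simps)
    then show ?case using c(1) d by auto
  qed
  then show thesis using that by blast
qed

section \<open>Correcting the exponent\<close>

text \<open>Adding \<open>(p - 1) * p ^ k * t\<close> to \<open>b\<close> changes
  \<open>2 ^ b\<close> by \<open>2 ^ b * c * t * p ^ Suc k\<close> modulo
  \<open>p ^ (k + 2)\<close>. As \<open>2 ^ b * c\<close> is invertible modulo \<open>p\<close>,
  some \<open>t\<close> cancels the remaining quotient \<open>q\<close>.\<close>

lemma add_power_two_lift:
  fixes r :: int
  assumes p: "prime p" "odd p" and nw: "\<not> wieferich_prime p" and dvd: "int p dvd r + 2 ^ a"
  shows "\<exists>b. int p ^ Suc k dvd r + 2 ^ b"
proof (induction k)
  case 0
  then show ?case using dvd by auto
next
  case (Suc k)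
  then obtain b q where q: "r + 2 ^ b = int p ^ Suc k * q" by (auto elim: dvdE)
  obtain c where c: "(2::int) ^ ((p - 1) * p ^ k) = 1 + int p ^ Suc k * c" "\<not> int p dvd c"
    using non_wieferich_power_exact[OF p nw] by blast
  have "coprime (int p) c"
    using p(1) c(2) by (simp add: prime_imp_coprime)
  then have "coprime (2 ^ b * c) (int p)"
    using p(2) by (simp add: coprime_commute)
  then obtain u where u: "[2 ^ b * c * u = 1] (mod int p)"
    using cong_solve_coprime_int by blast
  \<comment> \<open>This is \<open>- q / (2 ^ b * c)\<close> modulo \<open>p\<close>, taken as a
    nonnegative residue because it enters an exponent.\<close>
  define t where "t = nat ((- q * u) mod int p)"
  have "int t = (- q * u) mod int p"
    using prime_gt_0_nat[OF p(1)] by (simp add: t_def)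
  then have "[2 ^ b * c * int t = 2 ^ b * c * (- q * u)] (mod int p)"
    by (intro cong_scalar_left) (simp add: cong_def)
  also have "2 ^ b * c * (- q * u) = - q * (2 ^ b * c * u)" by simp
  also have "[- q * (2 ^ b * c * u) = - q * 1] (mod int p)"
    using u by (rule cong_scalar_left)
  finally have "int p dvd q + 2 ^ b * c * int t"
    by (simp add: cong_iff_dvd_diff algebra_simps)
  then obtain v where v: "q + 2 ^ b * c * int t = int p * v" ..
  define y where "y = int p ^ Suc k * c"
  obtain z where z: "(1 + y) ^ t = 1 + int t * y + y\<^sup>2 * z"
    using power_one_plus_linear[of y t] by auto
  have "(2::int) ^ (b + (p - 1) * p ^ k * t) = 2 ^ b * (1 + y) ^ t"
    unfolding power_add power_mult[of 2 "(p - 1) * p ^ k" t] c(1) y_def ..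
  then have "r + 2 ^ (b + (p - 1) * p ^ k * t) = (r + 2 ^ b) + 2 ^ b * int t * y + 2 ^ b * y\<^sup>2 * z"
    unfolding z by (simp add: algebra_simps)
  also have "\<dots> = int p ^ Suc k * (q + 2 ^ b * c * int t) + 2 ^ b * y\<^sup>2 * z"
    unfolding q by (simp add: y_def algebra_simps)
  \<comment> \<open>The square of \<open>y\<close> contains \<open>int p ^ (2 * k + 2)\<close>, so
    the error term is absorbed as well.\<close>
  also have "\<dots> = int p ^ Suc (Suc k) * (v + 2 ^ b * int p ^ k * c\<^sup>2 * z)"
    unfolding v by (simp add: y_def algebra_simps power2_eq_square)
  finally show ?case by (metis dvd_triv_left)
qed

section \<open>Bounds for \<open>M\<close> and the conclusion\<close>

lemma M_le_power:
  assumes "k \<ge> 1" "n > 0"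
  shows "M n \<le> M (n ^ k)"
proof -
  obtain j where j: "j \<ge> 1" "M (n ^ k) = s2 (j * n ^ k)" using M_attained by blast
  have "n ^ k = n ^ (k - 1) * n" using assms by (cases k) auto
  then have "M (n ^ k) = s2 ((j * n ^ (k - 1)) * n)" using j(2) by (simp add: ac_simps)
  moreover have "j * n ^ (k - 1) \<ge> 1" using j(1) assms(2) by (simp add: Suc_le_eq)
  ultimately show ?thesis using M_le by metis
qed

lemma M_le_dvd:
  assumes "n dvd m" "m > 0"
  shows "M n \<le> s2 m"
  using assms M_le by (auto elim!: dvdE simp: mult.commute[of n] Suc_le_eq)

lemma M_pos:
  assumes "n > 0"
  shows "M n > 0"
proof -
  obtain j where "j \<ge> 1" "M n = s2 (j * n)" using M_attained by blast
  with assms s2_split_power[of "j * n"] show ?thesis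
    by (metis mult_pos_pos less_le_trans zero_less_one zero_less_Suc)
qed

theorem theorem2:
  fixes p k :: nat
  assumes "prime p" and "\<not> wieferich_prime p" and "k \<ge> 1"
  shows "M p = M (p ^ k)"
proof (rule antisym)
  have pos: "p > 0" using assms(1) by (rule prime_gt_0_nat)
  show "M p \<le> M (p ^ k)" using M_le_power assms(3) pos by blast
  show "M (p ^ k) \<le> M p"
  proof (cases "odd p")
    case False
    \<comment> \<open>The lifting requires odd \<open>p\<close>; here \<open>2 ^ k\<close> is itself
      a multiple of weight one, the least possible.\<close>
    then have "p = 2" using assms(1) primes_dvd_imp_eq two_is_prime_nat by blast
    have "M (p ^ k) \<le> s2 (0 + 2 ^ k)"
      using M_le_dvd[of "p ^ k" "2 ^ k"] \<open>p = 2\<close> by simp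
    also have "\<dots> \<le> 1" using s2_add_power_le[of 0 k] by (simp add: s2_0)
    also have "\<dots> \<le> M p" using M_pos[OF pos] by simp
    finally show ?thesis .
  next
    case True
    obtain j where j: "j \<ge> 1" "M p = s2 (j * p)" using M_attained by blast
    then have "j * p > 0" using pos by simp
    then obtain r a where ra: "j * p = r + 2 ^ a" "s2 (j * p) = Suc (s2 r)"
      by (rule s2_split_power)
    have "int p dvd int (j * p)" by simp
    then have "int p dvd int r + 2 ^ a" unfolding ra(1) by simp
    \<comment> \<open>The lifting lemma counts from exponent 1, and \<open>Suc (k - 1) = k\<close>
      since \<open>k \<ge> 1\<close>.\<close>
    then obtain b where "int p ^ Suc (k - 1) dvd int r + 2 ^ b"
      using add_power_two_lift[OF assms(1) True assms(2)] by blast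
    then have "int (p ^ k) dvd int (r + 2 ^ b)" using assms(3) by simp
    then have "p ^ k dvd r + 2 ^ b" by (simp only: of_nat_dvd_iff)
    then have "M (p ^ k) \<le> s2 (r + 2 ^ b)" by (rule M_le_dvd) simp
    also have "\<dots> \<le> Suc (s2 r)" by (rule s2_add_power_le)
    finally show ?thesis using ra(2) j(2) by simp
  qed
qed

end
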